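(* For independent parameters (indeterminates) $t$ and $s$, $$\mathcal{Y}(z;t)\,\mathcal{Y}(w;s)=F_{t,s}(w/z)\;:\!\mathcal{Y}(z;t)\mathcal{Y}(w;s)\!:\,,$$ where $$F_{t,s}(u)=\exp\Big(-2\sum_{n\ge1,\ n\text{ odd}}\frac{1-s^n}{1-t^n}\frac{u^n}{n}\Big)\in\mathbb{K}[[u]],$$ with $\mathbb{K}=\mathbb{Q}(t,s)$. When $s=t$, $$F_{t,t}(u)=\frac{1-u}{1+u}.$$
   Context: Work over $\mathbb{K}=\mathbb{Q}(t,s)$ and on $\Gamma_{\mathbb{K}}=\mathbb{K}[p_1,p_3,p_5,\ldots]$. For odd $n\ge1$, $a_{-n}$ is multiplication by $p_n$ and $a_n=\frac n2\frac{\partial}{\partial p_n}$. For a parameter $t$ set $$A_t(z)=\sum_{n\ge1,\ n\text{ odd}}\frac{2(1-t^n)}{n}a_{-n}z^n,\qquad B_t(z)=-\sum_{n\ge1,\ n\text{ odd}}\frac{2}{n(1-t^n)}a_nz^{-n},$$ and $\mathcal{Y}(z;t)=e^{A_t(z)}e^{B_t(z)}$, a formal series in $z^{\pm1}$ with coefficients in the linear operators on $\Gamma_{\mathbb{K}}$; $\mathcal{Y}(w;s)$ is defined in the same way with $(z,t)$ replaced by $(w,s)$. The normally ordered product is $$:\!\mathcal{Y}(z;t)\mathcal{Y}(w;s)\!:\;=e^{A_t(z)+A_s(w)}e^{B_t(z)+B_s(w)}.$$ Scalar factors $F_{t,s}(w/z)$ are expanded as formal power series in $w/z$. *)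

theory Defs
  imports
    "HOL-Computational_Algebra.Computational_Algebra"
    "HOL-Library.Poly_Mapping"
    "HOL-Library.Groups_Big_Fun"
    "HOL-Library.Product_Plus"
begin

(* K = Q(t,s) is the fraction field of Q[t][s]: the inner poly variable is t, the outer one is s. *)
type_synonym K = "rat poly poly fract"

definition t_ind :: K where
  "t_ind = Fract [:[:0, 1:]:] 1"

definition s_ind :: K where
  "s_ind = Fract [:0, 1:] 1"

(* Gamma = K[p_1, p_3, p_5, ...]: a monomial is a finitely supported exponent function, in which
   the index k stands for the variable p_{2k+1}; a polynomial is a finitely supported family of
   coefficients on monomials, multiplied by convolution. *)
type_synonym gamma = "(nat \<Rightarrow>\<^sub>0 nat) \<Rightarrow>\<^sub>0 K"

type_synonym gamma_op = "gamma \<Rightarrow> gamma"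

definition scal :: "K \<Rightarrow> gamma_op" where
  "scal c f = Poly_Mapping.single 0 c * f"

(* Intended for odd n only: n = 2k+1 gives n div 2 = k. *)
definition p :: "nat \<Rightarrow> gamma" where
  "p n = Poly_Mapping.single (Poly_Mapping.single (n div 2) 1) 1"

(* The partial derivative with respect to p_n, n odd. If p_n does not occur in the monomial m, the
   truncated subtraction on exponents is harmless because the coefficient of the term is 0. *)
definition dp :: "nat \<Rightarrow> gamma_op" where
  "dp n f = (\<Sum>m\<in>Poly_Mapping.keys f.
     Poly_Mapping.single (m - Poly_Mapping.single (n div 2) 1)
       (of_nat (Poly_Mapping.lookup m (n div 2)) * Poly_Mapping.lookup f m))"

(* The operator a_n, used for odd integers n only. *)
definition heis :: "int \<Rightarrow> gamma_op" where
  "heis n f = (if n < 0 then p (nat (- n)) * f else scal (of_int n / 2) (dp (nat n) f))"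

(* Formal series with operator coefficients: X e is the coefficient of the monomial with exponent e.
   Exponents lie in int for series in z and in int * int for series in (z, w).

   Infinite sums of operators are evaluated pointwise with Sum_any, which sums over the (finite)
   support and is 0 on infinite supports. All sums arising below have finite support: creation parts
   involve only nonnegative powers of z and w, annihilation parts only nonpositive ones, and
   on a given polynomial all but finitely many coefficients of the latter vanish. *)
type_synonym 'e op_series = "'e \<Rightarrow> gamma_op"

definition ser_one :: "'e::ab_group_add op_series" where
  "ser_one e f = (if e = 0 then f else 0)"

definition ser_add :: "'e op_series \<Rightarrow> 'e op_series \<Rightarrow> 'e op_series" where
  "ser_add X Y e f = X e f + Y e f"

definition ser_mult ::
  "'e::ab_group_add op_series \<Rightarrow> 'e op_series \<Rightarrow> 'e op_series" where
  "ser_mult X Y e f = Sum_any (\<lambda>i. X i (Y (e - i) f))"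

primrec ser_pow :: "'e::ab_group_add op_series \<Rightarrow> nat \<Rightarrow> 'e op_series" where
  "ser_pow X 0 = ser_one"
| "ser_pow X (Suc r) = ser_mult X (ser_pow X r)"

definition ser_exp :: "'e::ab_group_add op_series \<Rightarrow> 'e op_series" where
  "ser_exp X e f = Sum_any (\<lambda>r. scal (1 / of_nat (fact r)) (ser_pow X r e f))"

definition in_z :: "int op_series \<Rightarrow> (int \<times> int) op_series" where
  "in_z X e f = (if snd e = 0 then X (fst e) f else 0)"

definition in_w :: "int op_series \<Rightarrow> (int \<times> int) op_series" where
  "in_w X e f = (if fst e = 0 then X (snd e) f else 0)"

definition A_ser :: "K \<Rightarrow> int op_series" where
  "A_ser q n f = (if n \<ge> 1 \<and> odd n
     then scal (2 * (1 - q ^ nat n) / of_int n) (heis (- n) f) else 0)"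

(* The summand with index n sits at exponent -n. *)
definition B_ser :: "K \<Rightarrow> int op_series" where
  "B_ser q e f = (let n = - e in if n \<ge> 1 \<and> odd n
     then scal (- (2 / (of_int n * (1 - q ^ nat n)))) (heis n f) else 0)"

definition Y_ser :: "K \<Rightarrow> int op_series" where
  "Y_ser q = ser_mult (ser_exp (A_ser q)) (ser_exp (B_ser q))"

(* The normally ordered product of Y(z;q) and Y(w;r). *)
definition normal_YY :: "K \<Rightarrow> K \<Rightarrow> (int \<times> int) op_series" where
  "normal_YY q r = ser_mult
     (ser_exp (ser_add (in_z (A_ser q)) (in_w (A_ser r))))
     (ser_exp (ser_add (in_z (B_ser q)) (in_w (B_ser r))))"

definition F_fps :: "K \<Rightarrow> K \<Rightarrow> K fps" where
  "F_fps q r = fps_exp 1 oo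
     (fps_const (- 2) * Abs_fps (\<lambda>n. if odd n
        then (1 - r ^ n) / (1 - q ^ n) * (1 / of_nat n) else 0))"

(* G(w/z) as a series of scalar operators: u^k becomes z^(-k) w^k. *)
definition at_w_over_z :: "K fps \<Rightarrow> (int \<times> int) op_series" where
  "at_w_over_z G e f = (if snd e \<ge> 0 \<and> fst e = - snd e
     then scal (fps_nth G (nat (snd e))) f else 0)"

end

theory Submission
  imports Defs
begin

text \<open>
  Write $E^A_n$ and $E^B_n$ for the coefficients of $e^{A_r(w)}$ and $e^{B_q(z)}$. The coefficients of
  $B_q(z)$ and $A_r(w)$ have scalar commutators: by the Heisenberg relation the commutator of
  $B_q(z)$ with $A_r(w)$ is the scalar series $L(w/z)$ with
  $L(u) = -2 \sum_{n\ \mathrm{odd}} \frac{1-r^n}{1-q^n} \frac{u^n}{n}$, hence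
  $e^{B_q(z)} e^{A_r(w)} = e^{L(w/z)} e^{A_r(w)} e^{B_q(z)}$, and the product formula follows because all the
  creation operators commute with each other, as do all the annihilation operators.

  Each exponential is handled through its Euler equation: if the coefficients \<open>S i\<close> of a series
  commute, and \<open>E\<close> is its exponential, then $wt(e) E_e = \sum_i wt(i) S_i E_{e-i}$
  (\<open>exp_Euler\<close>), and this determines \<open>E\<close> (\<open>exp_eqI\<close>). The equation gives the exponential of a sum of
  commuting series in two variables (\<open>exp_two_variables\<close>), it shows that the commutator of a
  single annihilation operator with $e^{A_r(w)}$ is a multiple of $e^{A_r(w)}$ (\<open>B_XA\<close>), and by
  induction on the weight it yields the coefficient form of the exchange relation (\<open>XB_XA\<close>),
  \[ E^B_u E^A_n = \sum_k F_k \, E^A_{n-k} E^B_{u+k}, \]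
  which uses of $F = e^L$ only $F_0 = 1$ and the Euler equation $n F_n = \sum_k k L_k F_{n-k}$.

  To assemble the coefficients into the products of series, one needs that only finitely many terms
  act nontrivially on a given polynomial. Give $p_n$ the weight \<open>n\<close>; then $E^B_{-m}$ lowers the weight
  by \<open>m\<close>, so it kills every polynomial of weight less than \<open>m\<close> (\<open>exp_B_ser_Fil\<close>).
  This argument (\<open>Y_product\<close>) works for arbitrary elements \<open>q\<close> and \<open>r\<close> of the field, with $1/0 = 0$.

  For equal parameters $L'(u) = -2/(1-u^2)$, and the resulting differential equation for \<open>F\<close>
  has the solution $(1-u)/(1+u)$ (\<open>F_fps_diagonal\<close>).
\<close>

section \<open>The space of polynomials and its linear operators\<close>

interpretation Gam: vector_space scal
  by unfold_locales
    (simp_all add: scal_def distrib_left distrib_right single_add mult_single flip: mult.assoc)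

text \<open>The $\mathbb{K}$-linear operators on the polynomial ring.\<close>

abbreviation lin :: "gamma_op \<Rightarrow> bool" where
  "lin \<equiv> module_hom scal scal"

lemma linI:
  assumes "\<And>f g. X (f + g) = X f + X g" and "\<And>c f. X (scal c f) = scal c (X f)"
  shows "lin X"
  using assms Gam.module_axioms by (simp add: module_hom_iff)

lemma lin_add: "lin X \<Longrightarrow> X (f + g) = X f + X g"
  by (rule module_hom.add)

lemma lin_scal: "lin X \<Longrightarrow> X (scal c f) = scal c (X f)"
  by (rule module_hom.scale)

lemma lin_zero: "lin X \<Longrightarrow> X 0 = 0"
  by (rule module_hom.zero)

lemma lin_sum: "lin X \<Longrightarrow> X (sum g I) = (\<Sum>i\<in>I. X (g i))"
  by (rule module_hom.sum)

lemma lin_compose: "lin X \<Longrightarrow> lin Y \<Longrightarrow> lin (\<lambda>f. X (Y f))"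
  by (auto intro!: linI simp: lin_add lin_scal)

lemma lin_comb: "(\<And>i. i \<in> I \<Longrightarrow> lin (X i)) \<Longrightarrow> lin (\<lambda>f. \<Sum>i\<in>I. scal (c i) (X i f))"
  by (intro linI)
    (simp_all add: lin_add lin_scal Gam.scale_right_distrib sum.distrib Gam.scale_sum_right mult.commute)

lemma lin_mult: "lin (\<lambda>f. g * f)"
  by (intro linI) (simp_all add: distrib_left scal_def mult.left_commute)

lemma lin_scal_op: "lin X \<Longrightarrow> lin (\<lambda>f. scal c (X f))"
  by (intro linI) (simp_all add: lin_add lin_scal Gam.scale_right_distrib mult.commute)

lemma lin_const_zero: "lin (\<lambda>f. 0)"
  by (intro linI) simp_all

lemma lin_ident: "lin (\<lambda>f. f)"
  by (intro linI) simp_all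

section \<open>Exponentials of graded families of commuting operators\<close>

lemma diff_swap: "a - b - c = a - c - (b::'a::ab_group_add)"
  by (simp add: algebra_simps)

text \<open>A cone of exponents on which an additive weight is positive away from the origin, with
  finitely many exponents of bounded weight.\<close>

locale graded_cone =
  fixes C :: "'e::ab_group_add set" and wt :: "'e \<Rightarrow> int"
  assumes wt_add: "wt (x + y) = wt x + wt y"
    and zero_mem: "0 \<in> C"
    and add_mem: "x \<in> C \<Longrightarrow> y \<in> C \<Longrightarrow> x + y \<in> C"
    and wt_pos: "x \<in> C \<Longrightarrow> x \<noteq> 0 \<Longrightarrow> 0 < wt x"
    and finite_wt: "finite {x \<in> C. wt x \<le> n}"
begin

text \<open>The exponents below \<open>e\<close>, that is, those \<open>i\<close> for which both \<open>i\<close> and \<open>e - i\<close> lie in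
  the cone.\<close>

definition below :: "'e \<Rightarrow> 'e set" where
  "below e = {i \<in> C. e - i \<in> C}"

lemma wt_zero: "wt 0 = 0"
  using wt_add[of 0 0] by simp

lemma wt_diff: "wt (x - y) = wt x - wt y"
  using wt_add[of "x - y" y] by simp

lemma wt_nonneg: "x \<in> C \<Longrightarrow> 0 \<le> wt x"
  using wt_pos[of x] wt_zero by (cases "x = 0") auto

lemma wt_split: "wt i + wt (e - i) = wt e"
  by (simp add: wt_diff)

lemma finite_below: "finite (below e)"
proof (rule finite_subset[OF _ finite_wt])
  show "below e \<subseteq> {x \<in> C. wt x \<le> wt e}"
    using wt_nonneg wt_diff by (fastforce simp: below_def)
qed

lemma sum_below_swap:
  fixes g :: "'e \<Rightarrow> 'e \<Rightarrow> 'b::comm_monoid_add"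
  shows "(\<Sum>i\<in>below e. \<Sum>j\<in>below (e - i). g i j) = (\<Sum>j\<in>below e. \<Sum>i\<in>below (e - j). g i j)"
proof -
  have A: "e - j \<in> C" if "e - i - j \<in> C" "i \<in> C" for i j
    using add_mem[OF that] by (simp add: algebra_simps)
  have "(\<Sum>i\<in>below e. \<Sum>j\<in>below (e - i). g i j) = (\<Sum>i\<in>below e. \<Sum>j | j \<in> below e \<and> j \<in> below (e - i). g i j)"
    by (intro sum.cong) (use A in \<open>auto simp: below_def\<close>)
  also have "\<dots> = (\<Sum>j\<in>below e. \<Sum>i | i \<in> below e \<and> j \<in> below (e - i). g i j)"
    by (rule sum.swap_restrict) (rule finite_below)+
  also have "\<dots> = (\<Sum>j\<in>below e. \<Sum>i\<in>below (e - j). g i j)"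
    by (intro sum.cong) (use A in \<open>auto simp: below_def diff_swap[of e]\<close>)
  finally show ?thesis .
qed

lemma ser_mult_below:
  assumes "\<And>i f. i \<notin> C \<Longrightarrow> X i f = 0" and "\<And>i. X i 0 = 0" and "\<And>i f. i \<notin> C \<Longrightarrow> Y i f = 0"
  shows "ser_mult X Y e f = (\<Sum>i\<in>below e. X i (Y (e - i) f))"
  unfolding ser_mult_def
  by (rule Sum_any.expand_superset[OF finite_below]) (use assms in \<open>force simp: below_def\<close>)

lemma below_outside: "e \<notin> C \<Longrightarrow> below e = {}"
  using add_mem by (fastforce simp: below_def)

end

text \<open>A family of commuting linear operators, supported in the cone with the origin removed.\<close>

locale exponent_series = graded_cone C wt for C :: "'e::ab_group_add set" and wt +
  fixes S :: "'e op_series"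
  assumes S_lin: "lin (S i)"
    and S_supp: "i \<notin> C \<Longrightarrow> S i f = 0"
    and S_origin: "S 0 f = 0"
    and S_comm: "S i (S j f) = S j (S i f)"
begin

lemma S_zero: "S i 0 = 0"
  using S_lin by (rule lin_zero)

lemma pow_supp: "e \<notin> C \<or> wt e < int r \<Longrightarrow> ser_pow S r e f = 0"
proof (induction r arbitrary: e f)
  case 0
  then have "e \<noteq> 0"
    using zero_mem wt_zero by auto
  then show ?case by (simp add: ser_one_def)
next
  case (Suc r)
  have "S i (ser_pow S r (e - i) f) = 0" for i
  proof (cases "i \<in> C \<and> i \<noteq> 0")
    case True
    then have "e - i \<notin> C \<or> wt (e - i) < int r"
      using Suc.prems add_mem[of i "e - i"] wt_pos[of i] wt_diff[of e i] by auto
    then show ?thesis by (simp add: Suc.IH S_zero)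
  qed (auto simp: S_supp S_origin)
  then show ?case by (simp add: ser_mult_def)
qed

lemma pow_Suc: "ser_pow S (Suc r) e f = (\<Sum>i\<in>below e. S i (ser_pow S r (e - i) f))"
  using ser_mult_below[of S "ser_pow S r" e f] S_supp S_zero pow_supp by simp

lemma pow_lin: "lin (ser_pow S r e)"
proof (induction r arbitrary: e)
  case 0
  have "lin (\<lambda>f. if e = 0 then f else 0)"
    by (cases "e = 0") (simp_all add: lin_const_zero lin_ident)
  then show ?case by (simp add: ser_one_def[abs_def])
next
  case (Suc r)
  have "lin (\<lambda>f. \<Sum>i\<in>below e. scal 1 (S i (ser_pow S r (e - i) f)))"
    by (rule lin_comb, rule lin_compose[OF S_lin Suc.IH])
  then show ?case by (simp add: pow_Suc[abs_def] del: ser_pow.simps)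
qed

text \<open>The Euler derivation multiplies the coefficient at \<open>e\<close> by the weight of \<open>e\<close>. As the
  coefficients of \<open>S\<close> commute, it sends \<open>S\<close> to the power \<open>r + 1\<close> to \<open>r + 1\<close> times the product of the
  derivative of \<open>S\<close> with \<open>S\<close> to the power \<open>r\<close>.\<close>

lemma pow_Euler:
  "scal (of_int (wt e)) (ser_pow S (Suc r) e f) =
     scal (of_nat (Suc r)) (\<Sum>i\<in>below e. scal (of_int (wt i)) (S i (ser_pow S r (e - i) f)))"
proof (induction r arbitrary: e)
  case 0
  have "scal (of_int (wt e)) (S i (ser_one (e - i) f)) = scal (of_int (wt i)) (S i (ser_one (e - i) f))"
    for i
    by (cases "e = i") (auto simp: ser_one_def S_zero)
  then show ?case by (subst pow_Suc) (simp add: Gam.scale_sum_right del: Gam.scale_cancel_right)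
next
  case (Suc r)
  let ?P = "ser_pow S"
  let ?D = "\<lambda>r e. \<Sum>i\<in>below e. scal (of_int (wt i)) (S i (?P r (e - i) f))"
  \<comment> \<open>The Leibniz rule for the Euler derivation, read off on coefficients.\<close>
  have split: "scal (of_int (wt e)) x = scal (of_int (wt i)) x + scal (of_int (wt (e - i))) x" for i x
    by (simp add: wt_split flip: Gam.scale_left_distrib of_int_add)
  have "scal (of_int (wt e)) (?P (Suc (Suc r)) e f)
      = (\<Sum>i\<in>below e. scal (of_int (wt e)) (S i (?P (Suc r) (e - i) f)))"
    by (subst pow_Suc) (simp add: Gam.scale_sum_right)
  also have "\<dots> = ?D (Suc r) e + (\<Sum>i\<in>below e. S i (scal (of_int (wt (e - i))) (?P (Suc r) (e - i) f)))"
    unfolding sum.distrib[symmetric] by (intro sum.cong refl) (metis split lin_scal[OF S_lin])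
  also have "(\<Sum>i\<in>below e. S i (scal (of_int (wt (e - i))) (?P (Suc r) (e - i) f)))
     = scal (of_nat (Suc r)) (\<Sum>i\<in>below e. \<Sum>j\<in>below (e - i).
          scal (of_int (wt j)) (S i (S j (?P r (e - i - j) f))))"
    unfolding Suc.IH by (simp add: lin_scal[OF S_lin] lin_sum[OF S_lin] Gam.scale_sum_right del: of_nat_Suc)
  also have "(\<Sum>i\<in>below e. \<Sum>j\<in>below (e - i). scal (of_int (wt j)) (S i (S j (?P r (e - i - j) f))))
     = (\<Sum>j\<in>below e. \<Sum>i\<in>below (e - j). scal (of_int (wt j)) (S j (S i (?P r (e - j - i) f))))"
    by (subst sum_below_swap) (simp add: S_comm diff_swap[of e])
  also have "\<dots> = ?D (Suc r) e"
    by (subst pow_Suc) (simp add: lin_sum[OF S_lin] Gam.scale_sum_right del: ser_pow.simps)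
  also have "?D (Suc r) e + scal (of_nat (Suc r)) (?D (Suc r) e) = scal (of_nat (Suc (Suc r))) (?D (Suc r) e)"
    by (simp only: of_nat_Suc[of "Suc r"] Gam.scale_left_distrib Gam.scale_one)
  finally show ?case .
qed

lemma exp_eq_sum:
  assumes "wt e \<le> int N"
  shows "ser_exp S e f = (\<Sum>r\<le>N. scal (1 / of_nat (fact r)) (ser_pow S r e f))"
  unfolding ser_exp_def
proof (rule Sum_any.expand_superset)
  show "{r. scal (1 / of_nat (fact r)) (ser_pow S r e f) \<noteq> 0} \<subseteq> {..N}"
    using pow_supp[of e _ f] assms by force
qed simp

lemma exp_supp: "e \<notin> C \<Longrightarrow> ser_exp S e f = 0"
  by (simp add: ser_exp_def pow_supp)

lemma exp_origin: "ser_exp S 0 f = f"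
  using exp_eq_sum[of 0 0 f] by (simp add: wt_zero ser_one_def)

lemma exp_lin: "lin (ser_exp S e)"
proof -
  have "lin (\<lambda>f. \<Sum>r\<le>nat (wt e). scal (1 / of_nat (fact r)) (ser_pow S r e f))"
    by (intro lin_comb pow_lin)
  moreover have "ser_exp S e = (\<lambda>f. \<Sum>r\<le>nat (wt e). scal (1 / of_nat (fact r)) (ser_pow S r e f))"
    by (intro ext exp_eq_sum) simp
  ultimately show ?thesis by simp
qed

lemma exp_zero: "ser_exp S e 0 = 0"
  using exp_lin by (rule lin_zero)

text \<open>The derivative of the exponential of \<open>S\<close> is the derivative of \<open>S\<close> times the exponential.\<close>

lemma exp_Euler:
  "scal (of_int (wt e)) (ser_exp S e f) = (\<Sum>i\<in>below e. scal (of_int (wt i)) (S i (ser_exp S (e - i) f)))"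
proof (cases "e \<in> C")
  case True
  let ?N = "nat (wt e)"
  let ?P = "ser_pow S"
  have N: "wt (e - i) \<le> int ?N" if "i \<in> below e" for i
    using that wt_nonneg[of i] by (auto simp: below_def wt_diff)
  have fact: "1 / of_nat (fact (Suc r)) * of_nat (Suc r) = (1 / of_nat (fact r) :: K)" for r
    by (simp only: fact_Suc of_nat_mult) (simp add: field_simps del: of_nat_Suc of_nat_fact)
  have zero: "scal (of_int (wt e)) (?P 0 e f) = 0"
    by (simp add: ser_one_def wt_zero)
  have "scal (of_int (wt e)) (ser_exp S e f)
      = scal (of_int (wt e)) (\<Sum>r\<le>Suc ?N. scal (1 / of_nat (fact r)) (?P r e f))"
    by (subst exp_eq_sum[of e "Suc ?N"]) auto
  also have "\<dots> = (\<Sum>r\<le>Suc ?N. scal (1 / of_nat (fact r)) (scal (of_int (wt e)) (?P r e f)))"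
    unfolding Gam.scale_sum_right by (intro sum.cong refl) (rule Gam.scale_left_commute)
  also have "\<dots> = (\<Sum>r\<le>?N. scal (1 / of_nat (fact (Suc r))) (scal (of_int (wt e)) (?P (Suc r) e f)))"
    unfolding sum.atMost_Suc_shift zero by simp
  also have "\<dots> = (\<Sum>r\<le>?N. scal (1 / of_nat (fact r)) (\<Sum>i\<in>below e. scal (of_int (wt i)) (S i (?P r (e - i) f))))"
    unfolding pow_Euler Gam.scale_scale fact ..
  also have "\<dots> = (\<Sum>i\<in>below e. scal (of_int (wt i)) (S i (\<Sum>r\<le>?N. scal (1 / of_nat (fact r)) (?P r (e - i) f))))"
    unfolding lin_sum[OF S_lin] lin_scal[OF S_lin] Gam.scale_sum_right
    by (subst sum.swap) (simp add: mult.commute)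
  also have "\<dots> = (\<Sum>i\<in>below e. scal (of_int (wt i)) (S i (ser_exp S (e - i) f)))"
    by (intro sum.cong refl) (simp add: exp_eq_sum[OF N])
  finally show ?thesis .
qed (simp add: exp_supp below_outside)

text \<open>The Euler equation determines the coefficients of positive weight recursively.\<close>

lemma exp_eqI:
  assumes origin: "\<And>f. E 0 f = f"
    and supp: "\<And>e f. e \<notin> C \<Longrightarrow> E e f = 0"
    and Euler: "\<And>e f. scal (of_int (wt e)) (E e f) = (\<Sum>i\<in>below e. scal (of_int (wt i)) (S i (E (e - i) f)))"
  shows "E e f = ser_exp S e f"
proof (induction "nat (wt e)" arbitrary: e rule: less_induct)
  case less
  show ?case
  proof (cases "e \<in> C \<and> e \<noteq> 0")
    case True
    have "scal (of_int (wt e)) (E e f) = scal (of_int (wt e)) (ser_exp S e f)"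
      unfolding Euler exp_Euler
    proof (intro sum.cong refl)
      fix i assume i: "i \<in> below e"
      show "scal (of_int (wt i)) (S i (E (e - i) f)) = scal (of_int (wt i)) (S i (ser_exp S (e - i) f))"
      proof (cases "i = 0")
        case False
        then have "nat (wt (e - i)) < nat (wt e)"
          using i True wt_pos[of i] wt_pos[of e] by (auto simp: below_def wt_diff)
        then show ?thesis by (simp add: less)
      qed (simp add: S_origin)
    qed
    then show ?thesis
      using wt_pos[of e] True by (simp add: Gam.scale_left_imp_eq)
  qed (auto simp: origin supp exp_origin exp_supp)
qed

text \<open>An operator that commutes with all coefficients of a series commutes with those of its
  exponential.\<close>

lemma exp_commute:
  assumes T: "lin T" and comm: "\<And>i f. T (S i f) = S i (T f)"
  shows "T (ser_exp S e f) = ser_exp S e (T f)"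
proof (induction "nat (wt e)" arbitrary: e rule: less_induct)
  case less
  show ?case
  proof (cases "e \<in> C \<and> e \<noteq> 0")
    case True
    have "scal (of_int (wt e)) (T (ser_exp S e f)) = T (scal (of_int (wt e)) (ser_exp S e f))"
      by (simp add: lin_scal[OF T])
    also have "\<dots> = (\<Sum>i\<in>below e. scal (of_int (wt i)) (S i (T (ser_exp S (e - i) f))))"
      by (simp add: exp_Euler lin_sum[OF T] lin_scal[OF T] comm)
    also have "\<dots> = (\<Sum>i\<in>below e. scal (of_int (wt i)) (S i (ser_exp S (e - i) (T f))))"
    proof (intro sum.cong refl)
      fix i assume i: "i \<in> below e"
      show "scal (of_int (wt i)) (S i (T (ser_exp S (e - i) f))) = scal (of_int (wt i)) (S i (ser_exp S (e - i) (T f)))"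
      proof (cases "i = 0")
        case False
        then have "nat (wt (e - i)) < nat (wt e)"
          using i True wt_pos[of i] wt_pos[of e] by (auto simp: below_def wt_diff)
        then show ?thesis by (simp add: less)
      qed (simp add: S_origin)
    qed
    also have "\<dots> = scal (of_int (wt e)) (ser_exp S e (T f))"
      by (simp add: exp_Euler)
    finally show ?thesis
      using wt_pos[of e] True by (simp add: Gam.scale_left_imp_eq)
  qed (auto simp: exp_origin exp_supp lin_zero[OF T])
qed

end

lemma graded_cone_Times:
  assumes "graded_cone C wt" and "graded_cone D wd"
  shows "graded_cone (C \<times> D) (\<lambda>e. wt (fst e) + wd (snd e))"
proof -
  interpret c: graded_cone C wt by fact
  interpret d: graded_cone D wd by fact
  show ?thesis
  proof
    fix x assume x: "x \<in> C \<times> D" "x \<noteq> 0"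
    then have "0 \<le> wt (fst x)" "0 \<le> wd (snd x)" "0 < wt (fst x) \<or> 0 < wd (snd x)"
      using c.wt_nonneg[of "fst x"] d.wt_nonneg[of "snd x"] c.wt_pos[of "fst x"] d.wt_pos[of "snd x"]
      by (auto simp: prod_eq_iff)
    then show "0 < wt (fst x) + wd (snd x)"
      by linarith
  next
    fix n
    have "{e \<in> C \<times> D. wt (fst e) + wd (snd e) \<le> n} \<subseteq> {x \<in> C. wt x \<le> n} \<times> {x \<in> D. wd x \<le> n}"
    proof
      fix e assume "e \<in> {e \<in> C \<times> D. wt (fst e) + wd (snd e) \<le> n}"
      then show "e \<in> {x \<in> C. wt x \<le> n} \<times> {x \<in> D. wd x \<le> n}"
        using c.wt_nonneg[of "fst e"] d.wt_nonneg[of "snd e"] by (cases e) simp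
    qed
    then show "finite {e \<in> C \<times> D. wt (fst e) + wd (snd e) \<le> n}"
      by (rule finite_subset) (intro finite_cartesian_product c.finite_wt d.finite_wt)
  qed (simp_all add: c.wt_add d.wt_add c.zero_mem d.zero_mem c.add_mem d.add_mem mem_Times_iff)
qed

text \<open>For commuting families, the exponential of \<open>S(z) + T(w)\<close> is the product of the exponential of
  \<open>S(z)\<close> and the exponential of \<open>T(w)\<close>: both satisfy the same differential equation for the total
  weight.\<close>

lemma exp_two_variables:
  assumes "exponent_series C wt S" and "exponent_series D wd T"
    and comm: "\<And>i j f. S i (T j f) = T j (S i f)"
  shows "exponent_series (C \<times> D) (\<lambda>e. wt (fst e) + wd (snd e)) (ser_add (in_z S) (in_w T))"
    and "ser_exp (ser_add (in_z S) (in_w T)) e f = ser_exp S (fst e) (ser_exp T (snd e) f)"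
proof -
  interpret s: exponent_series C wt S by fact
  interpret t: exponent_series D wd T by fact
  let ?U = "ser_add (in_z S) (in_w T)"
  have U: "?U i g = (if snd i = 0 then S (fst i) g else 0) + (if fst i = 0 then T (snd i) g else 0)" for i g
    by (simp add: ser_add_def in_z_def in_w_def)
  show "exponent_series (C \<times> D) (\<lambda>e. wt (fst e) + wd (snd e)) ?U"
  proof (intro exponent_series.intro graded_cone_Times exponent_series_axioms.intro)
    fix i show "lin (?U i)"
      by (intro linI) (auto simp: U lin_add[OF s.S_lin] lin_add[OF t.S_lin] lin_scal[OF s.S_lin]
          lin_scal[OF t.S_lin] Gam.scale_right_distrib)
  next
    fix i f assume "i \<notin> C \<times> D"
    then show "?U i f = 0"
      using s.zero_mem t.zero_mem by (cases i) (auto simp: U s.S_supp t.S_supp)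
  next
    fix i j f show "?U i (?U j f) = ?U j (?U i f)"
      by (simp add: U s.S_zero t.S_zero s.S_origin t.S_origin s.S_comm t.S_comm comm
          lin_add[OF s.S_lin] lin_add[OF t.S_lin])
  qed (use s.graded_cone_axioms t.graded_cone_axioms in \<open>auto simp: U s.S_origin t.S_origin\<close>)
  then interpret u: exponent_series "C \<times> D" "\<lambda>e. wt (fst e) + wd (snd e)" ?U .
  let ?X = "ser_exp S" and ?Y = "ser_exp T"
  have TX: "T j (?X a g) = ?X a (T j g)" for j a g
    by (rule s.exp_commute) (simp_all add: t.S_lin comm)
  have "?X (fst e) (?Y (snd e) f) = ser_exp ?U e f"
  proof (rule u.exp_eqI)
    fix e :: "int \<times> int" and f assume "e \<notin> C \<times> D"
    then show "?X (fst e) (?Y (snd e) f) = 0"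
      by (cases e) (auto simp: s.exp_supp t.exp_supp s.exp_zero)
  next
    fix e :: "int \<times> int" and f
    obtain a b where e: "e = (a, b)" by (cases e)
    show "scal (of_int (wt (fst e) + wd (snd e))) (?X (fst e) (?Y (snd e) f))
      = (\<Sum>i\<in>u.below e. scal (of_int (wt (fst i) + wd (snd i)))
           (?U i (?X (fst (e - i)) (?Y (snd (e - i)) f))))" (is "?L = ?R")
    proof (cases "e \<in> C \<times> D")
      case False
      then have "?X a (?Y b f) = 0"
        by (auto simp: e s.exp_supp t.exp_supp s.exp_zero)
      then show ?thesis by (simp add: u.below_outside[OF False]) (simp add: e)
    next
      case True
      have below: "u.below e = s.below a \<times> t.below b"
        by (auto simp: e u.below_def s.below_def t.below_def)
      have a0: "0 \<in> s.below a" and b0: "0 \<in> t.below b"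
        using True s.zero_mem t.zero_mem by (auto simp: e s.below_def t.below_def)
      have "?R = (\<Sum>i\<in>s.below a. \<Sum>j\<in>t.below b.
            (if j = 0 then scal (of_int (wt i)) (S i (?X (a - i) (?Y b f))) else 0)
          + (if i = 0 then scal (of_int (wd j)) (T j (?X a (?Y (b - j) f))) else 0))"
        unfolding below sum.cartesian_product
        by (intro sum.cong refl)
          (auto simp: U e Gam.scale_right_distrib s.wt_zero t.wt_zero s.S_origin t.S_origin)
      also have "\<dots> = (\<Sum>i\<in>s.below a. \<Sum>j\<in>t.below b.
            if j = 0 then scal (of_int (wt i)) (S i (?X (a - i) (?Y b f))) else 0)
          + (\<Sum>j\<in>t.below b. \<Sum>i\<in>s.below a.
            if i = 0 then scal (of_int (wd j)) (T j (?X a (?Y (b - j) f))) else 0)"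
        unfolding sum.distrib by (rule arg_cong2[of _ _ _ _ "(+)", OF refl sum.swap])
      also have "\<dots> = (\<Sum>i\<in>s.below a. scal (of_int (wt i)) (S i (?X (a - i) (?Y b f))))
          + (\<Sum>j\<in>t.below b. scal (of_int (wd j)) (T j (?X a (?Y (b - j) f))))"
        using a0 b0 by (simp add: s.finite_below t.finite_below)
      also have "(\<Sum>i\<in>s.below a. scal (of_int (wt i)) (S i (?X (a - i) (?Y b f))))
          = scal (of_int (wt a)) (?X a (?Y b f))"
        by (rule s.exp_Euler[symmetric])
      also have "(\<Sum>j\<in>t.below b. scal (of_int (wd j)) (T j (?X a (?Y (b - j) f))))
          = ?X a (\<Sum>j\<in>t.below b. scal (of_int (wd j)) (T j (?Y (b - j) f)))"
        by (simp add: lin_sum[OF s.exp_lin] lin_scal[OF s.exp_lin] TX)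
      also have "\<dots> = scal (of_int (wd b)) (?X a (?Y b f))"
        by (simp add: t.exp_Euler[symmetric] lin_scal[OF s.exp_lin])
      finally show ?thesis
        by (simp add: e Gam.scale_left_distrib)
    qed
  qed (simp add: s.exp_origin t.exp_origin)
  then show "ser_exp ?U e f = ?X (fst e) (?Y (snd e) f)" ..
qed

section \<open>Moving annihilation operators past creation operators\<close>

lemma graded_cone_nonneg: "graded_cone {0::int..} (\<lambda>n. n)"
  by unfold_locales (auto intro: finite_subset[of _ "{0..n}" for n])

lemma graded_cone_nonpos: "graded_cone {..0::int} uminus"
proof unfold_locales
  fix n :: int
  have "{x \<in> {..0}. - x \<le> n} \<subseteq> {- n..0}" by auto
  then show "finite {x \<in> {..0}. - x \<le> n}" by (rule finite_subset) simp
qed auto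

text \<open>A creation series \<open>A\<close> in positive powers and an annihilation series \<open>B\<close> in negative powers,
  whose coefficients satisfy the Heisenberg relation with structure constants \<open>c\<close>.\<close>

locale heisenberg_series =
  A: exponent_series "{0..}" "\<lambda>n. n" A + B: exponent_series "{..0}" uminus B
  for A B :: "int op_series" +
  fixes c :: "nat \<Rightarrow> K"
  assumes commutator: "B (- int m) (A n f) = A n (B (- int m) f) + (if n = int m then scal (c m) f else 0)"
    and c_zero: "c 0 = 0"
begin

abbreviation "XA \<equiv> ser_exp A"
abbreviation "XB \<equiv> ser_exp B"

lemma XA_Euler:
  assumes "n \<le> int N"
  shows "scal (of_int n) (XA n f) = (\<Sum>k\<le>N. scal (of_nat k) (A (int k) (XA (n - int k) f)))"
proof -
  have "(\<Sum>k\<le>N. scal (of_nat k) (A (int k) (XA (n - int k) f)))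
      = (\<Sum>i\<in>int ` {..N}. scal (of_int i) (A i (XA (n - i) f)))"
    by (simp add: sum.reindex)
  also have "\<dots> = (\<Sum>i\<in>A.below n. scal (of_int i) (A i (XA (n - i) f)))"
  proof (rule sum.mono_neutral_right)
    show "A.below n \<subseteq> int ` {..N}"
      using assms by (auto simp: A.below_def image_iff intro!: bexI[of _ "nat _"])
    show "\<forall>i\<in>int ` {..N} - A.below n. scal (of_int i) (A i (XA (n - i) f)) = 0"
    proof
      fix i assume "i \<in> int ` {..N} - A.below n"
      then have "n - i \<notin> {0..}" by (auto simp: A.below_def)
      then show "scal (of_int i) (A i (XA (n - i) f)) = 0"
        using A.exp_supp[of "n - i" f] by (simp add: A.S_zero)
    qed
  qed simp
  finally show ?thesis
    using A.exp_Euler[of n f] by simp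
qed

lemma XB_Euler:
  assumes "- u \<le> int N"
  shows "scal (of_int (- u)) (XB u f) = (\<Sum>k\<le>N. scal (of_nat k) (B (- int k) (XB (u + int k) f)))"
proof -
  have "(\<Sum>k\<le>N. scal (of_nat k) (B (- int k) (XB (u + int k) f)))
      = (\<Sum>i\<in>(\<lambda>k. - int k) ` {..N}. scal (of_int (- i)) (B i (XB (u - i) f)))"
    by (subst sum.reindex) (auto simp: inj_on_def)
  also have "\<dots> = (\<Sum>i\<in>B.below u. scal (of_int (- i)) (B i (XB (u - i) f)))"
  proof (rule sum.mono_neutral_right)
    show "B.below u \<subseteq> (\<lambda>k. - int k) ` {..N}"
      using assms by (auto simp: B.below_def image_iff intro!: bexI[of _ "nat (- _)"])
    show "\<forall>i\<in>(\<lambda>k. - int k) ` {..N} - B.below u. scal (of_int (- i)) (B i (XB (u - i) f)) = 0"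
    proof
      fix i assume "i \<in> (\<lambda>k. - int k) ` {..N} - B.below u"
      then have "u - i \<notin> {..0}" by (auto simp: B.below_def)
      then show "scal (of_int (- i)) (B i (XB (u - i) f)) = 0"
        using B.exp_supp[of "u - i" f] by (simp add: B.S_zero)
    qed
  qed simp
  finally show ?thesis
    using B.exp_Euler[of u f] by simp
qed

text \<open>Commuting with a single annihilation operator acts on the exponential of \<open>A\<close> as a
  derivation.\<close>

lemma B_XA:
  "B (- int m) (XA n f) = XA n (B (- int m) f) + scal (c m) (XA (n - int m) f)"
proof (induction "nat n" arbitrary: n rule: less_induct)
  case less
  consider "n < 0" | "n = 0" | "n > 0" by linarith
  then show ?case
  proof cases
    case 1
    then show ?thesis by (simp add: A.exp_supp B.S_zero)
  next
    case 2
    then show ?thesis by (cases "m = 0") (auto simp: A.exp_origin A.exp_supp c_zero)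
  next
    case 3
    let ?N = "nat n + m" and ?g = "B (- int m) f"
    have term_eq: "scal (of_nat k) (B (- int m) (A (int k) (XA (n - int k) f)))
        = scal (of_nat k) (A (int k) (XA (n - int k) ?g))
          + scal (c m) (scal (of_nat k) (A (int k) (XA (n - int m - int k) f)))
          + (if k = m then scal (of_nat m) (scal (c m) (XA (n - int m) f)) else 0)" for k
    proof (cases "k = 0")
      case False
      then have IH: "B (- int m) (XA (n - int k) f)
          = XA (n - int k) ?g + scal (c m) (XA (n - int k - int m) f)"
        using 3 by (intro less) auto
      show ?thesis
        by (simp add: commutator IH lin_add[OF A.S_lin] lin_scal[OF A.S_lin] Gam.scale_right_distrib
            Gam.scale_left_commute diff_swap[of n "int k"])
    qed auto
    have "scal (of_int n) (B (- int m) (XA n f)) = B (- int m) (scal (of_int n) (XA n f))"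
      by (simp add: lin_scal[OF B.S_lin])
    also have "\<dots> = (\<Sum>k\<le>?N. scal (of_nat k) (B (- int m) (A (int k) (XA (n - int k) f))))"
      by (subst XA_Euler[of n ?N]) (auto simp: lin_sum[OF B.S_lin] lin_scal[OF B.S_lin])
    also have "\<dots> = (\<Sum>k\<le>?N. scal (of_nat k) (A (int k) (XA (n - int k) ?g)))
        + scal (c m) (\<Sum>k\<le>?N. scal (of_nat k) (A (int k) (XA (n - int m - int k) f)))
        + scal (of_nat m) (scal (c m) (XA (n - int m) f))"
      unfolding term_eq sum.distrib Gam.scale_sum_right by simp
    also have "\<dots> = scal (of_int n) (XA n ?g) + scal (c m) (scal (of_int (n - int m)) (XA (n - int m) f))
        + scal (of_nat m) (scal (c m) (XA (n - int m) f))"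
      using XA_Euler[of n ?N ?g] XA_Euler[of "n - int m" ?N f] 3 by simp
    also have "\<dots> = scal (of_int n) (XA n ?g + scal (c m) (XA (n - int m) f))"
      by (simp add: Gam.scale_right_distrib Gam.scale_left_diff_distrib algebra_simps)
    finally show ?thesis
      using 3 by (simp only: Gam.scale_cancel_left) simp
  qed
qed

text \<open>If \<open>G\<close> is the exponential of the series with coefficients \<open>c\<close>, then exchanging the two
  exponentials produces the factor \<open>G(w/z)\<close>.\<close>

lemma XB_XA_aux:
  assumes G0: "fps_nth G 0 = 1"
    and G_Euler: "\<And>n. of_nat n * fps_nth G n = (\<Sum>k\<le>n. of_nat k * c k * fps_nth G (n - k))"
    and "m \<le> N"
  shows "XB (- int m) (XA n f) = (\<Sum>k\<le>N. scal (fps_nth G k) (XA (n - int k) (XB (- int m + int k) f)))"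
  using \<open>m \<le> N\<close>
proof (induction m arbitrary: N rule: less_induct)
  case (less m)
  let ?t = "\<lambda>l. XA (n - int l) (XB (- int m + int l) f)"
  have t_zero: "?t l = 0" if "l > m" for l
    using that by (simp add: B.exp_supp A.exp_zero)
  have extend: "(\<Sum>k\<le>N. scal (fps_nth G k) (?t k)) = (\<Sum>k\<le>m. scal (fps_nth G k) (?t k))"
    using less.prems by (intro sum.mono_neutral_right) (use t_zero in auto)
  show ?case
  proof (cases "m = 0")
    case True
    then show ?thesis unfolding extend by (simp add: B.exp_origin G0)
  next
    case False
    let ?u = "\<lambda>k j. XA (n - int j) (B (- int k) (XB (- int m + int j + int k) f))"
    \<comment> \<open>Here \<open>XB (- int m + int k)\<close> is moved to the right by induction, then \<open>B (- int k)\<close> by \<open>B_XA\<close>. The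
       term \<open>k = 0\<close>, for which the induction hypothesis is not available, has the coefficient 0.\<close>
    have term_eq: "scal (of_nat k) (B (- int k) (XB (- int m + int k) (XA n f)))
        = (\<Sum>j\<le>m. scal (fps_nth G j) (scal (of_nat k) (?u k j)))
          + (\<Sum>j\<le>m. scal (of_nat k * c k * fps_nth G j) (?t (k + j)))" if "k \<le> m" for k
    proof (cases "k = 0")
      case False
      have "XB (- int (m - k)) (XA n f)
          = (\<Sum>j\<le>m. scal (fps_nth G j) (XA (n - int j) (XB (- int (m - k) + int j) f)))"
        using False \<open>m \<noteq> 0\<close> by (intro less.IH) auto
      then have IH: "XB (- int m + int k) (XA n f)
          = (\<Sum>j\<le>m. scal (fps_nth G j) (XA (n - int j) (XB (- int m + int j + int k) f)))"
        using that by (simp add: of_nat_diff algebra_simps)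
      show ?thesis
        unfolding IH lin_sum[OF B.S_lin] lin_scal[OF B.S_lin] B_XA Gam.scale_sum_right
          Gam.scale_right_distrib sum.distrib
        by (simp add: algebra_simps)
    qed simp
    have first: "(\<Sum>k\<le>m. \<Sum>j\<le>m. scal (fps_nth G j) (scal (of_nat k) (?u k j)))
        = (\<Sum>j\<le>m. scal (of_nat (m - j) * fps_nth G j) (?t j))"
    proof (subst sum.swap, intro sum.cong refl)
      fix j assume j: "j \<in> {..m}"
      have "(\<Sum>k\<le>m. scal (of_nat k) (?u k j))
          = XA (n - int j) (\<Sum>k\<le>m. scal (of_nat k) (B (- int k) (XB (- int m + int j + int k) f)))"
        by (simp add: lin_sum[OF A.exp_lin] lin_scal[OF A.exp_lin])
      also have "\<dots> = XA (n - int j) (scal (of_int (- (- int m + int j))) (XB (- int m + int j) f))"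
        by (subst XB_Euler[of _ m]) auto
      also have "\<dots> = scal (of_nat (m - j)) (?t j)"
        using j by (simp add: lin_scal[OF A.exp_lin] of_nat_diff)
      finally show "(\<Sum>k\<le>m. scal (fps_nth G j) (scal (of_nat k) (?u k j)))
          = scal (of_nat (m - j) * fps_nth G j) (?t j)"
        unfolding Gam.scale_sum_right[symmetric] by (simp add: mult.commute)
    qed
    have "(\<Sum>k\<le>m. \<Sum>j\<le>m. scal (of_nat k * c k * fps_nth G j) (?t (k + j)))
        = (\<Sum>(k, j)\<in>{(k, j). k + j \<le> m}. scal (of_nat k * c k * fps_nth G j) (?t (k + j)))"
      unfolding sum.cartesian_product
    proof (rule sum.mono_neutral_right)
      show "\<forall>i\<in>{..m} \<times> {..m} - {(k, j). k + j \<le> m}.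
          (case i of (k, j) \<Rightarrow> scal (of_nat k * c k * fps_nth G j) (?t (k + j))) = 0"
      proof
        fix i assume i: "i \<in> {..m} \<times> {..m} - {(k, j). k + j \<le> m}"
        obtain k j where kj: "i = (k, j)" by (cases i)
        then have "?t (k + j) = 0"
          using i by (intro t_zero) auto
        then show "(case i of (k, j) \<Rightarrow> scal (of_nat k * c k * fps_nth G j) (?t (k + j))) = 0"
          by (simp only: kj prod.case Gam.scale_zero_right)
      qed
    qed auto
    also have "\<dots> = (\<Sum>l\<le>m. \<Sum>k\<le>l. scal (of_nat k * c k * fps_nth G (l - k)) (?t l))"
      by (subst sum.triangle_reindex_eq) simp
    also have "\<dots> = (\<Sum>l\<le>m. scal (of_nat l * fps_nth G l) (?t l))"
      by (simp add: G_Euler Gam.scale_sum_left)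
    finally have second: "(\<Sum>k\<le>m. \<Sum>j\<le>m. scal (of_nat k * c k * fps_nth G j) (?t (k + j)))
        = (\<Sum>l\<le>m. scal (of_nat l * fps_nth G l) (?t l))" .
    have "scal (of_nat m) (XB (- int m) (XA n f))
        = (\<Sum>k\<le>m. scal (of_nat k) (B (- int k) (XB (- int m + int k) (XA n f))))"
      using XB_Euler[of "- int m" m "XA n f"] by simp
    also have "\<dots> = (\<Sum>k\<le>m. (\<Sum>j\<le>m. scal (fps_nth G j) (scal (of_nat k) (?u k j)))
        + (\<Sum>j\<le>m. scal (of_nat k * c k * fps_nth G j) (?t (k + j))))"
      by (intro sum.cong refl term_eq) simp
    also have "\<dots> = (\<Sum>j\<le>m. scal (of_nat (m - j) * fps_nth G j) (?t j))
        + (\<Sum>l\<le>m. scal (of_nat l * fps_nth G l) (?t l))"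
      unfolding sum.distrib first second ..
    also have "\<dots> = scal (of_nat m) (\<Sum>k\<le>m. scal (fps_nth G k) (?t k))"
      unfolding sum.distrib[symmetric] Gam.scale_sum_right Gam.scale_left_distrib[symmetric]
      by (intro sum.cong refl) (simp add: of_nat_diff algebra_simps)
    finally show ?thesis
      unfolding extend using False by (simp only: Gam.scale_cancel_left) simp
  qed
qed

text \<open>As the coefficients of the exponential of \<open>A\<close> vanish at negative exponents, the sum may also be
  cut off at \<open>n\<close>, independently of \<open>u\<close>.\<close>

lemma XB_XA:
  assumes "fps_nth G 0 = 1"
    and "\<And>n. of_nat n * fps_nth G n = (\<Sum>k\<le>n. of_nat k * c k * fps_nth G (n - k))"
    and "n \<le> int N"
  shows "XB u (XA n f) = (\<Sum>k\<le>N. scal (fps_nth G k) (XA (n - int k) (XB (u + int k) f)))"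
proof (cases "u \<le> 0")
  case True
  then have "XB u (XA n f)
      = (\<Sum>k\<le>max N (nat (- u)). scal (fps_nth G k) (XA (n - int k) (XB (u + int k) f)))"
    using XB_XA_aux[OF assms(1,2), of "nat (- u)" "max N (nat (- u))" n f] by simp
  also have "\<dots> = (\<Sum>k\<le>N. scal (fps_nth G k) (XA (n - int k) (XB (u + int k) f)))"
    using assms(3) by (intro sum.mono_neutral_right) (auto simp: A.exp_supp)
  finally show ?thesis .
qed (simp add: B.exp_supp A.exp_zero)

end

section \<open>Partial derivatives and the weight filtration\<close>

text \<open>Linear operators that agree on monomials are equal.\<close>

lemma lin_eqI_single:
  assumes "lin X" and "lin Y" and "\<And>m c. X (Poly_Mapping.single m c) = Y (Poly_Mapping.single m c)"
  shows "X f = Y f"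
proof -
  have f: "f = (\<Sum>m\<in>Poly_Mapping.keys f. Poly_Mapping.single m (Poly_Mapping.lookup f m))"
    by (rule poly_mapping_eqI)
      (auto simp: lookup_sum lookup_single when_def in_keys_iff sum.delta finite_keys)
  show ?thesis
    by (subst (1 2) f) (simp add: lin_sum[OF assms(1)] lin_sum[OF assms(2)] assms(3))
qed

lemma lookup_scal: "Poly_Mapping.lookup (scal c f) m = c * Poly_Mapping.lookup f m"
  unfolding scal_def mult_map_scale_conv_mult[symmetric] by (simp add: map.rep_eq when_def)

lemma scal_single: "scal c (Poly_Mapping.single m x) = Poly_Mapping.single m (c * x)"
  by (simp add: scal_def mult_single)

lemma dp_superset:
  assumes "finite M" and "Poly_Mapping.keys f \<subseteq> M"
  shows "dp n f = (\<Sum>m\<in>M. Poly_Mapping.single (m - Poly_Mapping.single (n div 2) 1)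
     (of_nat (Poly_Mapping.lookup m (n div 2)) * Poly_Mapping.lookup f m))"
  unfolding dp_def using assms by (intro sum.mono_neutral_left) (auto simp: in_keys_iff)

lemma dp_lin: "lin (dp n)"
proof (rule linI)
  fix f g :: gamma
  let ?M = "Poly_Mapping.keys f \<union> Poly_Mapping.keys g"
  have "Poly_Mapping.keys (f + g) \<subseteq> ?M"
    by (rule Poly_Mapping.keys_add)
  then show "dp n (f + g) = dp n f + dp n g"
    by (simp add: dp_superset[of ?M] lookup_add distrib_left single_add sum.distrib)
next
  fix c :: K and f :: gamma
  have "Poly_Mapping.keys (scal c f) \<subseteq> Poly_Mapping.keys f"
    by (auto simp: in_keys_iff lookup_scal)
  then show "dp n (scal c f) = scal c (dp n f)"
    by (simp add: dp_superset[of "Poly_Mapping.keys f"] lookup_scal Gam.scale_sum_right scal_single mult.left_commute)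
qed

lemma dp_single:
  "dp n (Poly_Mapping.single m c) =
     Poly_Mapping.single (m - Poly_Mapping.single (n div 2) 1) (of_nat (Poly_Mapping.lookup m (n div 2)) * c)"
  by (simp add: dp_superset[of "{m}"])

lemma dp_commute: "dp n (dp k f) = dp k (dp n f)"
proof (rule lin_eqI_single[OF lin_compose[OF dp_lin dp_lin] lin_compose[OF dp_lin dp_lin]])
  fix m c
  show "dp n (dp k (Poly_Mapping.single m c)) = dp k (dp n (Poly_Mapping.single m c))"
    by (cases "n div 2 = k div 2") (simp_all add: dp_single lookup_minus lookup_single when_def diff_diff_add ac_simps)
qed

text \<open>The product rule for the variables, in the form of the Heisenberg relation.\<close>

lemma dp_p_mult:
  assumes "odd n" and "odd k"
  shows "dp n (p k * f) = p k * dp n f + (if n = k then f else 0)"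
proof (rule lin_eqI_single[where X = "\<lambda>f. dp n (p k * f)"
      and Y = "\<lambda>f. p k * dp n f + (if n = k then f else 0)"])
  show "lin (\<lambda>f. dp n (p k * f))"
    by (rule lin_compose[OF dp_lin lin_mult])
  show "lin (\<lambda>f. p k * dp n f + (if n = k then f else 0))"
    by (intro linI) (auto simp: lin_add[OF dp_lin] lin_scal[OF dp_lin] lin_scal[OF lin_mult]
        Gam.scale_right_distrib distrib_left)
next
  fix m :: "nat \<Rightarrow>\<^sub>0 nat" and c :: K
  let ?n = "Poly_Mapping.single (n div 2) 1 :: nat \<Rightarrow>\<^sub>0 nat"
  let ?k = "Poly_Mapping.single (k div 2) 1 :: nat \<Rightarrow>\<^sub>0 nat"
  let ?x = "Poly_Mapping.lookup m (n div 2)"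
  \<comment> \<open>Without the side condition the truncated subtraction of exponents could fail to be associative.\<close>
  have shift: "?k + m - ?n = ?k + (m - ?n)" if "?x \<noteq> 0"
    using that by (intro poly_mapping_eqI) (auto simp: lookup_add lookup_minus lookup_single when_def)
  have L: "dp n (p k * Poly_Mapping.single m c)
      = Poly_Mapping.single (?k + m - ?n) (of_nat (Poly_Mapping.lookup (?k + m) (n div 2)) * c)"
    by (simp add: p_def mult_single dp_single)
  have R: "p k * dp n (Poly_Mapping.single m c) = Poly_Mapping.single (?k + (m - ?n)) (of_nat ?x * c)"
    by (simp add: p_def mult_single dp_single)
  show "dp n (p k * Poly_Mapping.single m c)
      = p k * dp n (Poly_Mapping.single m c) + (if n = k then Poly_Mapping.single m c else 0)"
  proof (cases "n = k")
    case True
    then have "?k + m - ?n = m" and "Poly_Mapping.lookup (?k + m) (n div 2) = Suc ?x"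
      by (simp_all add: lookup_add)
    moreover have "Poly_Mapping.single (?k + (m - ?n)) (of_nat ?x * c) = Poly_Mapping.single m (of_nat ?x * c)"
    proof (cases "?x = 0")
      case False
      then show ?thesis using shift True by simp
    qed simp
    ultimately show ?thesis
      unfolding L R using True by (simp add: distrib_right single_add add.commute)
  next
    case False
    then have "n div 2 \<noteq> k div 2"
      using assms by (metis odd_two_times_div_two_succ)
    then have "Poly_Mapping.lookup (?k + m) (n div 2) = ?x"
      by (simp add: lookup_add lookup_single when_def)
    then show ?thesis
      unfolding L R using False shift by (cases "?x = 0") simp_all
  qed
qed

text \<open>The weight of a monomial, where the variable $p_n$ has weight \<open>n\<close>; the index \<open>k\<close> of an
  exponent function stands for $p_{2k+1}$.\<close>

definition mono_wt :: "(nat \<Rightarrow>\<^sub>0 nat) \<Rightarrow> int" where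
  "mono_wt m = (\<Sum>k\<in>Poly_Mapping.keys m. int ((2 * k + 1) * Poly_Mapping.lookup m k))"

lemma mono_wt_nonneg: "0 \<le> mono_wt m"
  unfolding mono_wt_def by (intro sum_nonneg) simp

lemma mono_wt_superset:
  "finite M \<Longrightarrow> Poly_Mapping.keys m \<subseteq> M \<Longrightarrow> mono_wt m = (\<Sum>k\<in>M. int ((2 * k + 1) * Poly_Mapping.lookup m k))"
  unfolding mono_wt_def by (intro sum.mono_neutral_left) (auto simp: in_keys_iff)

lemma mono_wt_add: "mono_wt (m + m') = mono_wt m + mono_wt m'"
proof -
  let ?M = "Poly_Mapping.keys m \<union> Poly_Mapping.keys m'"
  have "Poly_Mapping.keys (m + m') \<subseteq> ?M"
    by (rule Poly_Mapping.keys_add)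
  then show ?thesis
    by (simp add: mono_wt_superset[of ?M] lookup_add sum.distrib[symmetric] algebra_simps)
qed

lemma mono_wt_single: "mono_wt (Poly_Mapping.single k 1) = int (2 * k + 1)"
  by (simp add: mono_wt_def)

text \<open>The space of polynomials of weight at most \<open>d\<close>.\<close>

definition Fil :: "int \<Rightarrow> gamma set" where
  "Fil d = {f. \<forall>m\<in>Poly_Mapping.keys f. mono_wt m \<le> d}"

lemma Fil_subspace: "Gam.subspace (Fil d)"
proof (rule Gam.subspaceI)
  fix f g assume "f \<in> Fil d" "g \<in> Fil d"
  then show "f + g \<in> Fil d"
    using Poly_Mapping.keys_add[of f g] by (auto simp: Fil_def)
qed (auto simp: Fil_def in_keys_iff lookup_scal)

lemma Fil_neg: "f \<in> Fil d \<Longrightarrow> d < 0 \<Longrightarrow> f = 0"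
  using mono_wt_nonneg by (metis (mono_tags, lifting) Fil_def all_not_in_conv keys_eq_empty
      linorder_not_le mem_Collect_eq order_trans)

lemma Fil_exists: "\<exists>d. f \<in> Fil d"
proof
  show "f \<in> Fil (\<Sum>m\<in>Poly_Mapping.keys f. mono_wt m)"
    by (auto simp: Fil_def intro!: member_le_sum mono_wt_nonneg)
qed

lemma dp_Fil:
  assumes "odd n" and "f \<in> Fil d"
  shows "dp n f \<in> Fil (d - int n)"
  unfolding dp_def
proof (rule Gam.subspace_sum[OF Fil_subspace])
  fix m assume m: "m \<in> Poly_Mapping.keys f"
  let ?s = "Poly_Mapping.single (n div 2) 1 :: nat \<Rightarrow>\<^sub>0 nat"
  have "mono_wt (m - ?s) = mono_wt m - int n" if "Poly_Mapping.lookup m (n div 2) \<noteq> 0"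
  proof -
    have "m = (m - ?s) + ?s"
      using that by (intro poly_mapping_eqI) (auto simp: lookup_add lookup_minus lookup_single when_def)
    then have "mono_wt m = mono_wt (m - ?s) + mono_wt ?s"
      by (metis mono_wt_add)
    moreover have "2 * (n div 2) + 1 = n"
      using assms(1) by presburger
    then have "mono_wt ?s = int n"
      by (simp only: mono_wt_single)
    ultimately show ?thesis by simp
  qed
  moreover have "mono_wt m \<le> d"
    using assms(2) m by (simp add: Fil_def)
  ultimately show "Poly_Mapping.single (m - ?s)
      (of_nat (Poly_Mapping.lookup m (n div 2)) * Poly_Mapping.lookup f m) \<in> Fil (d - int n)"
    by (auto simp: Fil_def)
qed

section \<open>The operator series\<close>

text \<open>The coefficient of the summand of index \<open>n\<close> of $A_q(z)$, and that of the summand of $B_q(z)$ at the exponent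
  \<open>u = - n\<close>, the factor \<open>n / 2\<close> of the annihilation operator included.\<close>

definition A_coeff :: "K \<Rightarrow> int \<Rightarrow> K" where
  "A_coeff q n = (if n \<ge> 1 \<and> odd n then 2 * (1 - q ^ nat n) / of_int n else 0)"

definition B_coeff :: "K \<Rightarrow> int \<Rightarrow> K" where
  "B_coeff q u = (if u \<le> -1 \<and> odd u
     then - (2 / (of_int (- u) * (1 - q ^ nat (- u)))) * (of_int (- u) / 2) else 0)"

lemma A_ser_eq: "A_ser q n f = scal (A_coeff q n) (p (nat n) * f)"
  by (simp add: A_ser_def heis_def A_coeff_def)

lemma B_ser_eq: "B_ser q u f = scal (B_coeff q u) (dp (nat (- u)) f)"
  by (auto simp: B_ser_def heis_def Let_def B_coeff_def)

lemma A_ser_lin: "lin (A_ser q n)"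
  using lin_scal_op[OF lin_mult] by (simp add: A_ser_eq[abs_def])

lemma B_ser_lin: "lin (B_ser q u)"
  using lin_scal_op[OF dp_lin] by (simp add: B_ser_eq[abs_def])

lemma A_ser_commute: "A_ser q i (A_ser r j f) = A_ser r j (A_ser q i f)"
  by (simp add: A_ser_eq lin_scal[OF lin_mult] mult.commute[of "A_coeff q i"]
      mult.left_commute[of "p (nat i)"])

lemma B_ser_commute: "B_ser q i (B_ser r j f) = B_ser r j (B_ser q i f)"
  by (simp add: B_ser_eq lin_scal[OF dp_lin] mult.commute[of "B_coeff q i"] dp_commute[of "nat (- i)"])

lemma A_ser_exponent: "exponent_series {0..} (\<lambda>n. n) (A_ser q)"
  by (intro exponent_series.intro graded_cone_nonneg exponent_series_axioms.intro A_ser_lin A_ser_commute)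
    (auto simp: A_ser_eq A_coeff_def)

lemma B_ser_exponent: "exponent_series {..0} uminus (B_ser q)"
  by (intro exponent_series.intro graded_cone_nonpos exponent_series_axioms.intro B_ser_lin B_ser_commute)
    (auto simp: B_ser_eq B_coeff_def)

text \<open>The logarithm of the scalar factor; its coefficients are the commutators of the coefficients of
  $B_q(z)$ and $A_r(w)$.\<close>

definition log_F :: "K \<Rightarrow> K \<Rightarrow> K fps" where
  "log_F q r = fps_const (- 2) * Abs_fps (\<lambda>n. if odd n
     then (1 - r ^ n) / (1 - q ^ n) * (1 / of_nat n) else 0)"

lemma log_F_nth:
  "fps_nth (log_F q r) n = (if odd n then - 2 * ((1 - r ^ n) / (1 - q ^ n) * (1 / of_nat n)) else 0)"
  unfolding log_F_def fps_mult_left_const_nth fps_nth_Abs_fps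
  by (auto simp only: mult_zero_right split: if_splits)

lemma F_fps_0: "fps_nth (F_fps q r) 0 = 1"
  by (simp add: F_fps_def fps_compose_nth_0)

lemma F_fps_deriv: "fps_deriv (F_fps q r) = F_fps q r * fps_deriv (log_F q r)"
proof -
  have "F_fps q r = fps_exp 1 oo log_F q r"
    by (simp add: F_fps_def log_F_def)
  then show ?thesis
    by (simp add: fps_compose_deriv log_F_nth)
qed

lemma F_fps_Euler:
  "of_nat n * fps_nth (F_fps q r) n
     = (\<Sum>k\<le>n. of_nat k * fps_nth (log_F q r) k * fps_nth (F_fps q r) (n - k))"
proof -
  have X: "fps_nth (fps_X * fps_deriv f) k = of_nat k * fps_nth f k" for f :: "K fps" and k
    by (cases k) simp_all
  have "of_nat n * fps_nth (F_fps q r) n = fps_nth ((fps_X * fps_deriv (log_F q r)) * F_fps q r) n"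
    by (simp add: F_fps_deriv mult_ac flip: X)
  also have "\<dots> = (\<Sum>k\<le>n. of_nat k * fps_nth (log_F q r) k * fps_nth (F_fps q r) (n - k))"
    by (subst fps_mult_nth) (simp only: X atMost_atLeast0)
  finally show ?thesis .
qed

text \<open>The operator $a_m$ contributes the factor $m/2$ to the commutator of $a_m$ and $a_{-m}$.\<close>

lemma commutator_B_A:
  "B_ser q (- int m) (A_ser r n f)
     = A_ser r n (B_ser q (- int m) f) + (if n = int m then scal (fps_nth (log_F q r) m) f else 0)"
proof (cases "odd m \<and> n \<ge> 1 \<and> odd n")
  case True
  define k where "k = nat n"
  with True have k: "n = int k" "odd k" "k \<noteq> 0"
    by (auto simp: even_nat_iff)
  from True have m: "odd m" "m \<noteq> 0" by (auto intro: Nat.gr0I)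
  define b where "b = - (2 / (of_nat m * (1 - q ^ m))) * (of_nat m / 2)"
  define a where "a = 2 * (1 - r ^ k) / of_nat k"
  have B: "B_ser q (- int m) g = scal b (dp m g)" for g
    using m by (simp add: B_ser_eq B_coeff_def b_def)
  have A: "A_ser r n g = scal a (p k * g)" for g
    using k by (simp add: A_ser_eq A_coeff_def a_def)
  have "scal b (dp m (scal a (p k * f))) = scal a (p k * scal b (dp m f)) + (if m = k then scal (a * b) f else 0)"
    using m k by (simp add: lin_scal[OF dp_lin] lin_scal[OF lin_mult] dp_p_mult Gam.scale_right_distrib
        mult.commute[of b a])
  moreover have "a * b = fps_nth (log_F q r) m" if "m = k"
  proof -
    \<comment> \<open>This holds for \<open>Q = 0\<close> too, where both sides are 0 because division by 0 gives 0.\<close>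
    have "2 * R / x * (- (2 / (x * Q)) * (x / 2)) = - 2 * (R / Q * (1 / x))" if "x \<noteq> 0" for R Q x :: K
      using that by (cases "Q = 0") (auto simp: field_simps)
    from this[of "of_nat m" "1 - r ^ m" "1 - q ^ m"] show ?thesis
      using that m by (simp only: a_def b_def log_F_nth if_True) simp
  qed
  ultimately show ?thesis
    unfolding A B using k by auto
next
  case False
  then show ?thesis
    by (auto simp: A_ser_eq B_ser_eq A_coeff_def B_coeff_def lin_zero[OF dp_lin] log_F_nth)
qed

lemma heisenberg_A_B: "heisenberg_series (A_ser r) (B_ser q) (fps_nth (log_F q r))"
  by (intro heisenberg_series.intro heisenberg_series_axioms.intro A_ser_exponent B_ser_exponent commutator_B_A)
    (simp add: log_F_nth)

text \<open>The coefficient of $e^{B_q(z)}$ at $z^u$ lowers the weight by \<open>- u\<close>.\<close>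

lemma exp_B_ser_Fil:
  assumes "f \<in> Fil d"
  shows "ser_exp (B_ser q) u f \<in> Fil (d + u)"
proof -
  interpret B: exponent_series "{..0}" uminus "B_ser q" by (rule B_ser_exponent)
  have B_Fil: "B_ser q i g \<in> Fil (e + i)" if "g \<in> Fil e" for i g e
  proof (cases "B_coeff q i = 0")
    case False
    then have "odd (nat (- i))" "int (nat (- i)) = - i"
      by (auto simp: B_coeff_def even_nat_iff split: if_splits)
    with dp_Fil[OF _ that, of "nat (- i)"] show ?thesis
      by (simp add: B_ser_eq Gam.subspace_scale[OF Fil_subspace])
  qed (simp add: B_ser_eq Gam.subspace_0[OF Fil_subspace])
  show ?thesis
  proof (induction "nat (- u)" arbitrary: u rule: less_induct)
    case less
    consider "u > 0" | "u = 0" | "u < 0" by linarith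
    then show ?case
    proof cases
      case 1
      then show ?thesis by (simp add: B.exp_supp Gam.subspace_0[OF Fil_subspace])
    next
      case 2
      then show ?thesis using assms by (simp add: B.exp_origin)
    next
      case 3
      have "scal (of_int (- i)) (B_ser q i (ser_exp (B_ser q) (u - i) f)) \<in> Fil (d + u)"
        if "i \<in> B.below u" for i
      proof (cases "i = 0")
        case False
        then have "ser_exp (B_ser q) (u - i) f \<in> Fil (d + (u - i))"
          using that 3 by (intro less) (auto simp: B.below_def)
        from B_Fil[OF this, of i] show ?thesis
          by (intro Gam.subspace_scale[OF Fil_subspace]) simp
      qed (simp add: B.S_origin Gam.subspace_0[OF Fil_subspace])
      then have "scal (of_int (- u)) (ser_exp (B_ser q) u f) \<in> Fil (d + u)"
        unfolding B.exp_Euler by (intro Gam.subspace_sum[OF Fil_subspace])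
      then have "scal (1 / of_int (- u)) (scal (of_int (- u)) (ser_exp (B_ser q) u f)) \<in> Fil (d + u)"
        by (rule Gam.subspace_scale[OF Fil_subspace])
      then show ?thesis using 3 by simp
    qed
  qed
qed

section \<open>The product formula\<close>

text \<open>By commutativity, the exponentials of \<open>A\<^sub>q(z) + A\<^sub>r(w)\<close> and of \<open>B\<^sub>q(z) + B\<^sub>r(w)\<close> split into products
  of one-variable exponentials.\<close>

lemma normal_YY_eq:
  "normal_YY q r (a, b) f = (\<Sum>(i, j). ser_exp (A_ser q) i (ser_exp (A_ser r) j
     (ser_exp (B_ser q) (a - i) (ser_exp (B_ser r) (b - j) f))))"
  unfolding normal_YY_def ser_mult_def
    exp_two_variables(2)[OF A_ser_exponent A_ser_exponent A_ser_commute]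
    exp_two_variables(2)[OF B_ser_exponent B_ser_exponent B_ser_commute]
  by (simp add: case_prod_beta)

lemma Y_ser_zero: "Y_ser q a 0 = 0"
  unfolding Y_ser_def ser_mult_def
  by (simp add: exponent_series.exp_zero[OF A_ser_exponent] exponent_series.exp_zero[OF B_ser_exponent])

lemma mult_in_z_in_w: "ser_mult (in_z (Y_ser q)) (in_w (Y_ser r)) (a, b) f = Y_ser q a (Y_ser r b f)"
proof -
  have "ser_mult (in_z (Y_ser q)) (in_w (Y_ser r)) (a, b) f
      = (\<Sum>e\<in>{(a, 0)}. in_z (Y_ser q) e (in_w (Y_ser r) ((a, b) - e) f))"
    unfolding ser_mult_def
    by (rule Sum_any.expand_superset) (auto simp: in_z_def in_w_def Y_ser_zero split: if_splits)
  then show ?thesis by (simp add: in_z_def in_w_def)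
qed

lemma Y_product:
  "ser_mult (in_z (Y_ser q)) (in_w (Y_ser r)) = ser_mult (at_w_over_z (F_fps q r)) (normal_YY q r)"
proof (intro ext)
  fix e :: "int \<times> int" and f :: gamma
  obtain a b where e: "e = (a, b)" by (cases e)
  obtain d where d: "f \<in> Fil d" using Fil_exists by blast
  interpret Aq: exponent_series "{0..}" "\<lambda>n. n" "A_ser q" by (rule A_ser_exponent)
  interpret Br: exponent_series "{..0}" uminus "B_ser r" by (rule B_ser_exponent)
  interpret H: heisenberg_series "A_ser r" "B_ser q" "fps_nth (log_F q r)" by (rule heisenberg_A_B)
  let ?Aq = "ser_exp (A_ser q)" and ?Ar = "ser_exp (A_ser r)"
  let ?Bq = "ser_exp (B_ser q)" and ?Br = "ser_exp (B_ser r)"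
  let ?F = "fps_nth (F_fps q r)"
  have Br_bound: "0 \<le> d + v" if "?Br v f \<noteq> 0" for v
    using that Fil_neg[OF exp_B_ser_Fil[OF d]] by force
  have Bq_bound: "0 \<le> d + v + u" if "?Bq u (?Br v f) \<noteq> 0" for u v
    using that Fil_neg[OF exp_B_ser_Fil[OF exp_B_ser_Fil[OF d]]] by force
  have bound: "0 \<le> i \<and> 0 \<le> j \<and> 0 \<le> d + v \<and> 0 \<le> d + v + u"
    if "?Aq i (?Ar j (?Bq u (?Br v f))) \<noteq> 0" for i j u v
  proof -
    have "?Br v f \<noteq> 0" "?Bq u (?Br v f) \<noteq> 0" "?Ar j (?Bq u (?Br v f)) \<noteq> 0"
      using that by (auto simp: Aq.exp_zero H.A.exp_zero H.B.exp_zero)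
    then show ?thesis
      using that Br_bound Bq_bound Aq.exp_supp[of i] H.A.exp_supp[of j] by force
  qed
  \<comment> \<open>Ranges outside of which every term vanishes on \<open>f\<close>; the index \<open>j\<close> is shifted by \<open>k\<close> in \<open>?t\<close>, so that
     these ranges do not depend on \<open>k\<close>.\<close>
  define I where "I = {0..a + b + d}"
  define J where "J = {0..b + d}"
  define N where "N = nat (b + d)"
  let ?t = "\<lambda>k i j. ?Aq i (?Ar (j - int k) (?Bq (a - i + int k) (?Br (b - j) f)))"
  have inner: "Y_ser r b f = (\<Sum>j\<in>J. ?Ar j (?Br (b - j) f))"
    unfolding Y_ser_def ser_mult_def
  proof (rule Sum_any.expand_superset)
    show "{j. ?Ar j (?Br (b - j) f) \<noteq> 0} \<subseteq> J"
    proof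
      fix j assume "j \<in> {j. ?Ar j (?Br (b - j) f) \<noteq> 0}"
      then have "?Br (b - j) f \<noteq> 0" "0 \<le> j"
        using H.A.exp_supp[of j] by (force simp: H.A.exp_zero)+
      then show "j \<in> J"
        using Br_bound[of "b - j"] by (auto simp: J_def)
    qed
  qed (simp add: J_def)
  have outer: "?Aq i (?Bq (a - i) (Y_ser r b f)) = (\<Sum>j\<in>J. \<Sum>k\<le>N. scal (?F k) (?t k i j))" for i
  proof -
    have "?Bq (a - i) (?Ar j g) = (\<Sum>k\<le>N. scal (?F k) (?Ar (j - int k) (?Bq (a - i + int k) g)))"
      if "j \<in> J" for j g
      using that by (intro H.XB_XA F_fps_0 F_fps_Euler) (auto simp: J_def N_def)
    then show ?thesis
      by (simp add: inner lin_sum[OF H.B.exp_lin] lin_sum[OF Aq.exp_lin] lin_scal[OF Aq.exp_lin])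
  qed
  have "Y_ser q a (Y_ser r b f) = (\<Sum>i\<in>I. ?Aq i (?Bq (a - i) (Y_ser r b f)))"
    unfolding Y_ser_def[of q] ser_mult_def
  proof (rule Sum_any.expand_superset)
    show "{i. ?Aq i (?Bq (a - i) (Y_ser r b f)) \<noteq> 0} \<subseteq> I"
    proof
      fix i assume "i \<in> {i. ?Aq i (?Bq (a - i) (Y_ser r b f)) \<noteq> 0}"
      then have "(\<Sum>j\<in>J. \<Sum>k\<le>N. scal (?F k) (?t k i j)) \<noteq> 0"
        by (simp add: outer)
      then obtain j k where "?t k i j \<noteq> 0"
        by (metis (no_types, lifting) Gam.scale_zero_right sum.neutral)
      from bound[OF this] show "i \<in> I" by (auto simp: I_def)
    qed
  qed (simp add: I_def)
  also have "\<dots> = (\<Sum>k\<le>N. scal (?F k) (\<Sum>(i, j)\<in>I \<times> J. ?t k i j))"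
    unfolding outer sum.cartesian_product[symmetric] Gam.scale_sum_right
    by (subst sum.swap[of _ "{..N}"]) (intro sum.cong refl sum.swap)
  also have "\<dots> = (\<Sum>k\<le>N. scal (?F k) (normal_YY q r (a + int k, b - int k) f))"
  proof (intro sum.cong refl arg_cong[where f = "scal _"])
    fix k
    let ?g = "\<lambda>(i, j). ?Aq i (?Ar j (?Bq (a + int k - i) (?Br (b - int k - j) f)))"
    let ?h = "\<lambda>(i, j). (i, j - int k)"
    have "normal_YY q r (a + int k, b - int k) f = sum ?g (?h ` (I \<times> J))"
      unfolding normal_YY_eq
    proof (rule Sum_any.expand_superset)
      show "{e. ?g e \<noteq> 0} \<subseteq> ?h ` (I \<times> J)"
      proof
        fix e assume "e \<in> {e. ?g e \<noteq> 0}"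
        then obtain i j where ij: "e = (i, j)"
          and "?Aq i (?Ar j (?Bq (a + int k - i) (?Br (b - int k - j) f))) \<noteq> 0"
          by (cases e) auto
        from bound[OF this(2)] have "(i, j + int k) \<in> I \<times> J"
          by (auto simp: I_def J_def)
        then show "e \<in> ?h ` (I \<times> J)"
          by (rule rev_image_eqI) (simp add: ij)
      qed
    qed (simp add: I_def J_def)
    also have "\<dots> = (\<Sum>(i, j)\<in>I \<times> J. ?t k i j)"
      by (subst sum.reindex) (auto simp: inj_on_def case_prod_beta algebra_simps intro!: sum.cong)
    finally show "(\<Sum>(i, j)\<in>I \<times> J. ?t k i j) = normal_YY q r (a + int k, b - int k) f" ..
  qed
  also have "\<dots> = ser_mult (at_w_over_z (F_fps q r)) (normal_YY q r) (a, b) f"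
  proof -
    let ?g = "\<lambda>e. at_w_over_z (F_fps q r) e (normal_YY q r ((a, b) - e) f)"
    let ?h = "\<lambda>k. (- int k, int k)"
    have "ser_mult (at_w_over_z (F_fps q r)) (normal_YY q r) (a, b) f = sum ?g (?h ` {..N})"
      unfolding ser_mult_def
    proof (rule Sum_any.expand_superset)
      show "{e. ?g e \<noteq> 0} \<subseteq> ?h ` {..N}"
      proof
        fix e assume "e \<in> {e. ?g e \<noteq> 0}"
        then have e: "snd e \<ge> 0" "fst e = - snd e" "normal_YY q r ((a, b) - e) f \<noteq> 0"
          by (auto simp: at_w_over_z_def split: if_splits)
        define k where "k = nat (snd e)"
        have e_eq: "e = ?h k"
          using e by (simp add: k_def prod_eq_iff)
        have "(\<Sum>(i, j). ?Aq i (?Ar j (?Bq (a + int k - i) (?Br (b - int k - j) f)))) \<noteq> 0"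
          using e(3) by (simp add: e_eq normal_YY_eq)
        then obtain i j where "?Aq i (?Ar j (?Bq (a + int k - i) (?Br (b - int k - j) f))) \<noteq> 0"
          by (rule Sum_any.not_neutral_obtains_not_neutral) auto
        from bound[OF this] have "k \<le> N" by (auto simp: N_def)
        then show "e \<in> ?h ` {..N}" by (auto simp: e_eq)
      qed
    qed simp
    also have "\<dots> = (\<Sum>k\<le>N. scal (?F k) (normal_YY q r (a + int k, b - int k) f))"
      by (subst sum.reindex) (auto simp: inj_on_def at_w_over_z_def)
    finally show ?thesis ..
  qed
  finally show "ser_mult (in_z (Y_ser q)) (in_w (Y_ser r)) e f
      = ser_mult (at_w_over_z (F_fps q r)) (normal_YY q r) e f"
    by (simp add: e mult_in_z_in_w)
qed

section \<open>Equal parameters\<close>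

lemma F_fps_diagonal:
  assumes "\<And>n. odd n \<Longrightarrow> q ^ n \<noteq> 1"
  shows "F_fps q q = (1 - fps_X) / (1 + fps_X)"
proof -
  let ?F = "F_fps q q"
  define H where "H = ?F * (1 + fps_X)"
  have "(1 - fps_X\<^sup>2) * fps_deriv (log_F q q) = - 2"
  proof (rule fps_ext)
    fix n
    have D: "fps_nth (fps_deriv (log_F q q)) n = (if even n then - 2 else 0)" for n
      using assms[of "Suc n"] by (simp add: log_F_nth del: power_Suc of_nat_Suc)
    show "fps_nth ((1 - fps_X\<^sup>2) * fps_deriv (log_F q q)) n = fps_nth (- 2) n"
      by (cases "n < 2"; cases "n = 0")
        (auto simp: left_diff_distrib fps_X_power_mult_nth D fps_numeral_nth simp del: fps_deriv_nth dest: less_2_cases)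
  qed
  moreover have "(1 - fps_X\<^sup>2) * fps_deriv ?F = ?F * ((1 - fps_X\<^sup>2) * fps_deriv (log_F q q))"
    unfolding F_fps_deriv by (rule mult.left_commute)
  ultimately have ODE: "(1 - fps_X\<^sup>2) * fps_deriv ?F = - 2 * ?F"
    by (simp only: mult.commute)
  have "(1 - fps_X) * fps_deriv H = (1 - fps_X\<^sup>2) * fps_deriv ?F + (1 - fps_X) * ?F"
    by (simp add: H_def algebra_simps power2_eq_square)
  also have "\<dots> = - H"
    unfolding ODE by (simp add: H_def algebra_simps)
  finally have H_ODE: "(1 - fps_X) * fps_deriv H = - H" .
  \<comment> \<open>The factor \<open>n - 1\<close> makes all coefficients from the second one on vanish.\<close>
  have H_rec: "of_nat (Suc n) * fps_nth H (Suc n) = (of_nat n - 1) * fps_nth H n" for n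
  proof -
    have "fps_nth ((1 - fps_X) * fps_deriv H) n = of_nat (Suc n) * fps_nth H (Suc n) - of_nat n * fps_nth H n"
      by (cases n) (simp_all add: left_diff_distrib)
    then show ?thesis unfolding H_ODE by (simp add: algebra_simps)
  qed
  have "fps_nth H n = fps_nth (1 - fps_X) n" for n
  proof (induction n)
    case 0
    show ?case by (simp add: H_def F_fps_0)
  next
    case (Suc n)
    have "of_nat (Suc n) * fps_nth H (Suc n) = of_nat (Suc n) * fps_nth (1 - fps_X) (Suc n)"
      unfolding H_rec Suc by (cases "n = 0 \<or> n = 1") auto
    then show ?case by (metis mult_left_cancel of_nat_neq_0)
  qed
  then have "H = 1 - fps_X" by (rule fps_ext)
  moreover have "1 + fps_X \<noteq> (0 :: K fps)"
    by (metis fps_add_nth fps_one_nth fps_X_nth fps_zero_nth add.right_neutral zero_neq_one)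
  ultimately show ?thesis
    unfolding H_def by (metis nonzero_mult_div_cancel_right)
qed

lemma t_ind_power_neq_1:
  assumes "n \<noteq> 0"
  shows "t_ind ^ n \<noteq> 1"
proof -
  have "t_ind ^ n = Fract [:[:0, 1:] ^ n:] 1"
    by (induction n) (simp_all add: t_ind_def One_fract_def one_pCons)
  moreover have "[:0, 1:] ^ n \<noteq> (1 :: rat poly)"
    using assms by (metis degree_1 degree_linear_power)
  ultimately show ?thesis
    by (simp add: One_fract_def eq_fract one_pCons)
qed

theorem theorem3p1:
  shows "ser_mult (in_z (Y_ser t_ind)) (in_w (Y_ser s_ind))
           = ser_mult (at_w_over_z (F_fps t_ind s_ind)) (normal_YY t_ind s_ind)
         \<and> F_fps t_ind t_ind = (1 - fps_X) / (1 + fps_X)"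
  using Y_product F_fps_diagonal t_ind_power_neq_1 by (metis odd_pos less_irrefl)

end
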